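(* Let $f:\mathbb{R}^n\to\mathbb{R}\cup\{\infty\}$ be a closed proper convex function, let $\mathcal{X}\subseteq\mathbb{R}^n$ be a convex set, and let $F:\mathbb{R}^n\times\mathbb{R}^m\to\mathbb{R}\cup\{\infty\}$ be any convex function such that $F(x,0)=f(x)$ for all $x$. Let $\|\cdot\|$ be any norm on $\mathbb{R}^m$. Define $$p(u)=\inf_{x\in\mathcal{X}}F(x,u)\quad(u\in\mathbb{R}^m),\qquad v(\tau)=\inf_{x\in\mathcal{X},\,u\in\mathbb{R}^m}\{\|u\|\mid F(x,u)\le\tau\}\quad(\tau\in\mathbb{R}),$$ and assume that the primal optimal value $\tau_p^*=p(0)=\inf_{x\in\mathcal{X}}f(x)$ is finite. Let $\tau_d^*:=p^{\star\star}(0)$, where $p^{\star\star}$ is the convex biconjugate of $p$. Then $$\tau_d^*=\inf\{\tau\in\mathbb{R}\mid v(\tau)=0\}\qquad\text{and}\qquad v(\tau)=0\ \text{ for all real }\tau>\tau_d^*.$$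
   Context: Infima and suprema are taken in the extended reals $[-\infty,+\infty]$, with $\inf\emptyset=+\infty$; $\tau_d^*=-\infty$ is allowed. For $p:\mathbb{R}^m\to[-\infty,+\infty]$, the conjugate is $p^\star(\mu)=\sup_u\{\langle\mu,u\rangle-p(u)\}$ and the biconjugate is $p^{\star\star}=(p^\star)^\star$, so $p^{\star\star}(0)=\sup_\mu\{-p^\star(\mu)\}$. The value $\tau_d^*$ is the optimal value of the dual problem associated with the perturbation function $F$. Here $f$ denotes the full objective of the unperturbed problem (it may take the value $+\infty$, so additional constraints can be absorbed into it). *)

theory Defs
  imports "HOL-Analysis.Analysis"
begin

text \<open>The library's \<open>epigraph\<close> and \<open>convex_on\<close> only cover real-valued functions; here functions
  take values in the extended reals, while the epigraph remains a subset of a real vector space.\<close>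

definition ereal_epigraph :: "('a \<Rightarrow> ereal) \<Rightarrow> ('a \<times> real) set" where
  "ereal_epigraph f = {(x, r). f x \<le> ereal r}"

definition ereal_convex :: "('a::real_vector \<Rightarrow> ereal) \<Rightarrow> bool" where
  "ereal_convex f \<longleftrightarrow> convex (ereal_epigraph f)"

definition ereal_closed :: "('a::topological_space \<Rightarrow> ereal) \<Rightarrow> bool" where
  "ereal_closed f \<longleftrightarrow> closed (ereal_epigraph f)"

definition ereal_proper :: "('a \<Rightarrow> ereal) \<Rightarrow> bool" where
  "ereal_proper f \<longleftrightarrow> (\<forall>x. f x \<noteq> -\<infinity>) \<and> (\<exists>x. f x \<noteq> \<infinity>)"

definition is_norm :: "('a::real_vector \<Rightarrow> real) \<Rightarrow> bool" where
  "is_norm N \<longleftrightarrow>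
     (\<forall>u. N u \<ge> 0) \<and> (\<forall>u. N u = 0 \<longleftrightarrow> u = 0) \<and>
     (\<forall>c u. N (c *\<^sub>R u) = \<bar>c\<bar> * N u) \<and>
     (\<forall>u w. N (u + w) \<le> N u + N w)"

text \<open>The minuend below is always finite, so the ambiguous difference \<open>\<infinity> - \<infinity>\<close> never occurs.\<close>

definition conjugate :: "('a::real_inner \<Rightarrow> ereal) \<Rightarrow> 'a \<Rightarrow> ereal" where
  "conjugate p \<mu> = (SUP u. ereal (\<mu> \<bullet> u) - p u)"

definition biconjugate :: "('a::real_inner \<Rightarrow> ereal) \<Rightarrow> 'a \<Rightarrow> ereal" where
  "biconjugate p = conjugate (conjugate p)"

definition perturbation_value :: "'a set \<Rightarrow> ('a \<times> 'b \<Rightarrow> ereal) \<Rightarrow> 'b \<Rightarrow> ereal" where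
  "perturbation_value X F u = (INF x\<in>X. F (x, u))"

text \<open>The least size, measured by \<open>N\<close>, of a perturbation for which the level \<open>\<tau>\<close> is reached;
  it is \<open>\<infinity>\<close> if there is none.\<close>

definition level_value ::
  "'a set \<Rightarrow> ('a \<times> 'b \<Rightarrow> ereal) \<Rightarrow> ('b \<Rightarrow> real) \<Rightarrow> real \<Rightarrow> ereal" where
  "level_value X F N \<tau> = Inf {ereal (N u) | x u. x \<in> X \<and> F (x, u) \<le> ereal \<tau>}"

end

theory Submission
  imports Defs
begin

text \<open>If \<open>v \<tau> = 0\<close>, then \<open>p\<close> takes values at most \<open>\<tau>\<close> arbitrarily close to \<open>0\<close>, so no affine minorant
  of \<open>p\<close> exceeds \<open>\<tau>\<close> at \<open>0\<close>. If \<open>v \<tau> > 0\<close>, then the convex set of pairs \<open>(u, r)\<close> with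
  \<open>F (x, u) \<le> r\<close> for some \<open>x \<in> X\<close> is disjoint from a cylinder \<open>{N u < e} \<times> {r < \<tau>}\<close>. A hyperplane
  separating the two is not vertical, because the first set meets the axis \<open>u = 0\<close>; hence it is the
  graph of an affine minorant of \<open>p\<close> whose value at \<open>0\<close> is at least \<open>\<tau>\<close>.\<close>

text \<open>Convexity makes \<open>N\<close> continuous, so \<open>N\<close> attains a minimum on
  the compact Euclidean unit sphere. Definiteness makes this minimum positive, and homogeneity
  carries the bound to all vectors.\<close>

lemma is_norm_bounds_norm:
  fixes N :: "'a::euclidean_space \<Rightarrow> real"
  assumes "is_norm N"
  shows "\<exists>c>0. \<forall>u. c * norm u \<le> N u"
proof -
  have nonneg: "\<And>u. N u \<ge> 0" and zero: "\<And>u. N u = 0 \<longleftrightarrow> u = 0"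
    and scale: "\<And>c u. N (c *\<^sub>R u) = \<bar>c\<bar> * N u" and tri: "\<And>u w. N (u + w) \<le> N u + N w"
    using assms by (auto simp: is_norm_def)
  have "convex_on UNIV N"
  proof (rule convex_onI)
    fix t x y assume "0 < t" "t < (1::real)"
    then show "N ((1 - t) *\<^sub>R x + t *\<^sub>R y) \<le> (1 - t) * N x + t * N y"
      using tri[of "(1 - t) *\<^sub>R x" "t *\<^sub>R y"] by (simp add: scale)
  qed auto
  then have "continuous_on UNIV N"
    by (rule convex_on_continuous[OF open_UNIV])
  then have "continuous_on (sphere 0 1) N"
    by (rule continuous_on_subset) simp
  moreover have "sphere (0::'a) 1 \<noteq> {}"
    by simp
  ultimately obtain w where w: "w \<in> sphere 0 1" and min: "\<And>u. u \<in> sphere 0 1 \<Longrightarrow> N w \<le> N u"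
    using continuous_attains_inf[OF compact_sphere] by metis
  from w have "N w \<noteq> 0"
    by (auto simp: zero)
  with nonneg[of w] have "N w > 0"
    by simp
  moreover have "N w * norm u \<le> N u" for u
  proof (cases "u = 0")
    case False
    then have "N w \<le> N ((1 / norm u) *\<^sub>R u)"
      by (intro min) simp
    with False show ?thesis
      by (simp add: scale field_simps)
  qed (simp add: nonneg)
  ultimately show ?thesis
    by blast
qed

text \<open>The infimum need not be attained, so a zero value only supplies perturbations of
  arbitrarily small size. If level \<open>\<tau>\<close> is never reached, the value is
  \<open>\<infinity>\<close> and both sides fail.\<close>

lemma level_value_eq_0_iff:
  assumes "\<And>u. N u \<ge> 0"
  shows "level_value X F N \<tau> = 0 \<longleftrightarrow>
    (\<forall>e>0. \<exists>x\<in>X. \<exists>u. F (x, u) \<le> ereal \<tau> \<and> N u < e)" (is "?L \<longleftrightarrow> ?R")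
proof
  assume L: ?L
  show ?R
  proof (intro allI impI)
    fix e :: real assume "e > 0"
    with L have "Inf {ereal (N u) | x u. x \<in> X \<and> F (x, u) \<le> ereal \<tau>} < ereal e"
      by (simp add: level_value_def)
    then show "\<exists>x\<in>X. \<exists>u. F (x, u) \<le> ereal \<tau> \<and> N u < e"
      unfolding Inf_less_iff by fastforce
  qed
next
  assume R: ?R
  have "level_value X F N \<tau> \<ge> 0"
    unfolding level_value_def using assms by (intro Inf_greatest) auto
  moreover have "level_value X F N \<tau> \<le> 0"
  proof (rule ereal_le_epsilon2)
    fix e :: real assume "e > 0"
    with R obtain x u where "x \<in> X" "F (x, u) \<le> ereal \<tau>" "N u < e"
      by blast
    then have "level_value X F N \<tau> \<le> ereal (N u)"
      unfolding level_value_def by (intro Inf_lower) auto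
    also have "\<dots> \<le> 0 + ereal e"
      using \<open>N u < e\<close> by simp
    finally show "level_value X F N \<tau> \<le> 0 + ereal e" .
  qed
  ultimately show ?L
    by (rule order_antisym[rotated])
qed

lemma biconjugate_0: "biconjugate p 0 = (SUP \<mu>. - conjugate p \<mu>)"
  by (simp add: biconjugate_def conjugate_def[of "conjugate p"] zero_ereal_def[symmetric])

lemma biconjugate_0_le_if_level_value_eq_0:
  fixes F :: "'a \<times> 'b::euclidean_space \<Rightarrow> ereal"
  assumes N: "is_norm N" and zero: "level_value X F N \<tau> = 0"
  shows "biconjugate (perturbation_value X F) 0 \<le> ereal \<tau>"
  unfolding biconjugate_0
proof (rule SUP_least)
  let ?p = "perturbation_value X F"
  fix \<mu>
  obtain c where c: "c > 0" "\<And>u. c * norm u \<le> N u"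
    using is_norm_bounds_norm[OF N] by blast
  have "ereal (- \<tau>) \<le> conjugate ?p \<mu>"
  proof (rule ereal_le_epsilon2)
    fix e :: real assume "e > 0"
    \<comment> \<open>Since \<open>c * norm u \<le> N u\<close>, the bound \<open>N u < d\<close>
      forces \<open>norm u * (norm \<mu> + 1) < e\<close>, and Cauchy-Schwarz then keeps
      \<open>- (\<mu> \<bullet> u)\<close> below \<open>e\<close>. The summand \<open>1\<close>
      covers \<open>\<mu> = 0\<close>.\<close>
    define d where "d = c * e / (norm \<mu> + 1)"
    have "d > 0"
      using \<open>e > 0\<close> c by (simp add: d_def add_nonneg_pos)
    then obtain x u where xu: "x \<in> X" "F (x, u) \<le> ereal \<tau>" "N u < d"
      using zero N by (subst (asm) level_value_eq_0_iff) (auto simp: is_norm_def)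
    from c(2)[of u] xu have "c * norm u < d"
      by simp
    then have "c * (norm u * (norm \<mu> + 1)) < c * e"
      using add_nonneg_pos[OF norm_ge_zero[of \<mu>] zero_less_one]
      by (simp add: d_def pos_less_divide_eq mult.assoc)
    then have "norm u * (norm \<mu> + 1) < e"
      using c(1) by simp
    moreover have "- (\<mu> \<bullet> u) \<le> norm \<mu> * norm u"
      using Cauchy_Schwarz_ineq2[of \<mu> u] by simp
    ultimately have small: "- (\<mu> \<bullet> u) \<le> e"
      using norm_ge_zero[of u] unfolding distrib_left mult.commute[of "norm u"] by linarith
    have "?p u \<le> ereal \<tau>"
      using xu by (auto simp: perturbation_value_def intro: INF_lower2)
    then have "ereal (\<mu> \<bullet> u) - ereal \<tau> \<le> ereal (\<mu> \<bullet> u) - ?p u"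
      by (intro ereal_minus_mono) auto
    also have "\<dots> \<le> conjugate ?p \<mu>"
      unfolding conjugate_def by (rule SUP_upper) simp
    finally have "ereal (\<mu> \<bullet> u - \<tau>) + ereal e \<le> conjugate ?p \<mu> + ereal e"
      by (intro add_right_mono) simp
    moreover have "ereal (- \<tau>) \<le> ereal (\<mu> \<bullet> u - \<tau>) + ereal e"
      using small by simp
    ultimately show "ereal (- \<tau>) \<le> conjugate ?p \<mu> + ereal e"
      by (rule order_trans[rotated])
  qed
  then show "- conjugate ?p \<mu> \<le> ereal \<tau>"
    by (simp add: ereal_uminus_le_reorder)
qed

text \<open>This is the part of the epigraph of \<open>F\<close> over \<open>X\<close>, projected
  along \<open>x\<close>. Unlike in the epigraph of the infimum over \<open>x\<close>, each point
  comes with a witness \<open>x\<close>, so convex combinations of witnesses suffice.\<close>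

lemma convex_projected_epigraph:
  fixes F :: "'a::real_vector \<times> 'b::real_vector \<Rightarrow> ereal"
  assumes "convex X" "ereal_convex F"
  shows "convex {(u, r). \<exists>x\<in>X. F (x, u) \<le> ereal r}"
proof (rule convexI, clarsimp)
  fix u1 r1 u2 r2 x1 x2 and s t :: real
  assume st: "0 \<le> s" "0 \<le> t" "s + t = 1"
    and x: "x1 \<in> X" "x2 \<in> X" and F: "F (x1, u1) \<le> ereal r1" "F (x2, u2) \<le> ereal r2"
  have "s *\<^sub>R ((x1, u1), r1) + t *\<^sub>R ((x2, u2), r2) \<in> ereal_epigraph F"
    using assms(2) F st by (intro convexD) (auto simp: ereal_convex_def ereal_epigraph_def)
  moreover have "s *\<^sub>R x1 + t *\<^sub>R x2 \<in> X"
    using assms(1) x st by (intro convexD)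
  ultimately show "\<exists>x\<in>X. F (x, s *\<^sub>R u1 + t *\<^sub>R u2) \<le> ereal (s * r1 + t * r2)"
    by (auto simp: ereal_epigraph_def)
qed

lemma is_norm_convex_ball:
  assumes "is_norm N"
  shows "convex {u. N u < e}"
proof (rule convexI, clarsimp)
  fix u w and s t :: real
  assume st: "0 \<le> s" "0 \<le> t" "s + t = 1" and less: "N u < e" "N w < e"
  have "N (s *\<^sub>R u + t *\<^sub>R w) \<le> s * N u + t * N w"
    using assms st unfolding is_norm_def by (metis abs_of_nonneg)
  also have "\<dots> < e"
    using less st by (rule convex_bound_lt)
  finally show "N (s *\<^sub>R u + t *\<^sub>R w) < e" .
qed

lemma le_biconjugate_0_if_level_value_neq_0:
  fixes F :: "'a::real_vector \<times> 'b::euclidean_space \<Rightarrow> ereal"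
  assumes X: "convex X" and F: "ereal_convex F" and N: "is_norm N"
    and finite: "perturbation_value X F 0 < \<infinity>"
    and nonzero: "level_value X F N \<tau> \<noteq> 0"
  shows "ereal \<tau> \<le> biconjugate (perturbation_value X F) 0"
proof -
  let ?p = "perturbation_value X F"
  obtain e where e: "e > 0" and far: "\<And>x u. x \<in> X \<Longrightarrow> F (x, u) \<le> ereal \<tau> \<Longrightarrow> \<not> N u < e"
    using nonzero N by (subst (asm) level_value_eq_0_iff) (auto simp: is_norm_def)
  have N0: "N 0 = 0" and scale: "\<And>c u. N (c *\<^sub>R u) = \<bar>c\<bar> * N u" and nonneg: "\<And>u. N u \<ge> 0"
    using N by (auto simp: is_norm_def)
  define A where "A = {(u, r). \<exists>x\<in>X. F (x, u) \<le> ereal r}"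
  \<comment> \<open>A point of \<open>A\<close> in this cylinder would have a witness
    \<open>x\<close> with \<open>F (x, u) \<le> ereal \<tau>\<close> and \<open>N u < e\<close>,
    against \<open>far\<close>.\<close>
  define B where "B = {u. N u < e} \<times> {..<\<tau>}"
  obtain r0 where r0: "(0, r0) \<in> A"
  proof -
    obtain x where x: "x \<in> X" "F (x, 0) < \<infinity>"
      using finite unfolding perturbation_value_def INF_less_iff by blast
    then obtain r where "F (x, 0) \<le> ereal r"
      by (cases "F (x, 0)") auto
    with x that show ?thesis
      by (auto simp: A_def)
  qed
  have inB: "(u, r) \<in> B" if "N u < e" "r < \<tau>" for u r
    using that by (simp add: B_def)
  have "convex A"
    unfolding A_def using X F by (rule convex_projected_epigraph)
  moreover have "convex B"
    unfolding B_def using is_norm_convex_ball[OF N]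
    by (intro convex_Times) auto
  moreover have "A \<inter> B = {}"
    using far unfolding A_def B_def
    by (auto, meson ereal_less_eq(3) less_imp_le order_trans)
  moreover have "A \<noteq> {}"
    using r0 by blast
  moreover have "B \<noteq> {}"
    using inB[of 0 "\<tau> - 1"] e N0 by auto
  ultimately obtain z c where z: "z \<noteq> 0" "\<forall>y\<in>B. z \<bullet> y \<le> c" "\<forall>y\<in>A. c \<le> z \<bullet> y"
    by (metis separating_hyperplane_sets Int_commute)
  obtain a b where ab: "z = (a, b)"
    by (rule prod.exhaust)
  have ge: "c \<le> a \<bullet> u + b * r" if "(u, r) \<in> A" for u r
    using z(3)[rule_format, OF that] by (simp add: ab)
  have le: "a \<bullet> u + b * r \<le> c" if "N u < e" "r < \<tau>" for u r
    using z(2)[rule_format, OF inB[OF that]] by (simp add: ab)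
  have axis: "b * r \<le> c" if "r < \<tau>" for r
    using le[of 0 r] that e N0 by simp
  \<comment> \<open>The axis of \<open>B\<close> is unbounded below: for negative \<open>b\<close>,
    heights \<open>r\<close> below \<open>c / b\<close> would push \<open>b * r\<close> above
    \<open>c\<close>.\<close>
  have "b \<ge> 0"
  proof (rule ccontr)
    assume "\<not> b \<ge> 0"
    define r where "r = min (\<tau> - 1) (c / b - 1)"
    have "r < \<tau>" "r < c / b"
      by (auto simp: r_def)
    then show False
      using axis[of r] \<open>\<not> b \<ge> 0\<close> by (simp add: field_simps)
  qed
  moreover have "b \<noteq> 0"
  proof
    assume "b = 0"
    with z(1) ab have "a \<noteq> 0"
      by (simp add: zero_prod_def)
    \<comment> \<open>This scaling puts \<open>t *\<^sub>R a\<close> into the ball of radius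
      \<open>e\<close>. A vertical hyperplane would then need \<open>c > 0\<close>, whereas the
      point \<open>(0, r0)\<close> of \<open>A\<close> forces \<open>c \<le> 0\<close>.\<close>
    define t where "t = e / (N a + 1)"
    have "t > 0"
      using e nonneg[of a] by (simp add: t_def add_nonneg_pos)
    have "N (t *\<^sub>R a) < e"
      using e nonneg[of a] by (simp add: scale t_def field_simps add_nonneg_pos)
    then have "t * (a \<bullet> a) \<le> c"
      using le[of "t *\<^sub>R a" "\<tau> - 1"] \<open>b = 0\<close> by simp
    moreover have "c \<le> 0"
      using ge[OF r0] \<open>b = 0\<close> by simp
    moreover have "t * (a \<bullet> a) > 0"
      using \<open>t > 0\<close> \<open>a \<noteq> 0\<close> by simp
    ultimately show False
      by simp
  qed
  ultimately have b: "b > 0"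
    by simp
  \<comment> \<open>Let \<open>r\<close> tend to \<open>\<tau>\<close> from below in
    \<open>b * r \<le> c\<close>.\<close>
  have "\<tau> \<le> c / b"
  proof (rule dense_le)
    fix r assume "r < \<tau>"
    with axis[of r] b show "r \<le> c / b"
      by (simp add: pos_le_divide_eq mult.commute)
  qed
  \<comment> \<open>Solving \<open>a \<bullet> u + b * r = c\<close> for \<open>r\<close> gives an
    affine function of \<open>u\<close> with slope \<open>\<mu>\<close> and value
    \<open>c / b\<close> at \<open>0\<close>.\<close>
  define \<mu> where "\<mu> = - (1 / b) *\<^sub>R a"
  have minorant: "ereal (c / b + \<mu> \<bullet> u) \<le> ?p u" for u
    unfolding perturbation_value_def
  proof (rule INF_greatest)
    fix x assume "x \<in> X"
    show "ereal (c / b + \<mu> \<bullet> u) \<le> F (x, u)"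
    \<comment> \<open>Testing against real upper bounds \<open>r\<close> of \<open>F (x, u)\<close>
      turns the claim into a statement on points \<open>(u, r)\<close> of \<open>A\<close>, and the
      value \<open>\<infinity>\<close> needs no separate case.\<close>
    proof (rule ereal_le_real)
      fix r assume "F (x, u) \<le> ereal r"
      with \<open>x \<in> X\<close> have "c \<le> a \<bullet> u + b * r"
        by (intro ge) (auto simp: A_def)
      with b show "ereal (c / b + \<mu> \<bullet> u) \<le> ereal r"
        by (simp add: \<mu>_def field_simps)
    qed
  qed
  have "conjugate ?p \<mu> \<le> ereal (- \<tau>)"
    unfolding conjugate_def
  proof (rule SUP_least)
    fix u
    have "ereal (\<mu> \<bullet> u) - ?p u \<le> ereal (\<mu> \<bullet> u) - ereal (c / b + \<mu> \<bullet> u)"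
      using minorant by (intro ereal_minus_mono) auto
    also have "\<dots> \<le> ereal (- \<tau>)"
      using \<open>\<tau> \<le> c / b\<close> by simp
    finally show "ereal (\<mu> \<bullet> u) - ?p u \<le> ereal (- \<tau>)" .
  qed
  then have "ereal \<tau> \<le> - conjugate ?p \<mu>"
    using ereal_minus_le_minus[of "ereal (- \<tau>)"] by simp
  also have "\<dots> \<le> biconjugate ?p 0"
    unfolding biconjugate_0 by (rule SUP_upper) simp
  finally show ?thesis .
qed

theorem theorem5p2:
  fixes f :: "real ^ 'n \<Rightarrow> ereal"
    and X :: "(real ^ 'n) set"
    and F :: "(real ^ 'n) \<times> (real ^ 'm) \<Rightarrow> ereal"
    and N :: "real ^ 'm \<Rightarrow> real"
    and p :: "real ^ 'm \<Rightarrow> ereal"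
    and v :: "real \<Rightarrow> ereal"
    and \<tau>\<^sub>d :: ereal
  assumes f_closed: "ereal_closed f"
    and f_proper: "ereal_proper f"
    and f_convex: "ereal_convex f"
    and X_convex: "convex X"
    and F_not_MInfty: "\<And>z. F z \<noteq> -\<infinity>"
    and F_convex: "ereal_convex F"
    and F_zero: "\<And>x. F (x, 0) = f x"
    and N_norm: "is_norm N"
    and p_def: "p = perturbation_value X F"
    and v_def: "v = level_value X F N"
    and primal_finite: "\<bar>p 0\<bar> \<noteq> \<infinity>"
    and dual_def: "\<tau>\<^sub>d = biconjugate p 0"
  shows "\<tau>\<^sub>d = Inf {ereal \<tau> | \<tau>. v \<tau> = 0} \<and> (\<forall>\<tau>::real. \<tau>\<^sub>d < ereal \<tau> \<longrightarrow> v \<tau> = 0)"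
proof -
  have lower: "\<tau>\<^sub>d \<le> ereal \<tau>" if "v \<tau> = 0" for \<tau>
    using biconjugate_0_le_if_level_value_eq_0[OF N_norm] that
    by (simp add: dual_def p_def v_def)
  have zero: "v \<tau> = 0" if "\<tau>\<^sub>d < ereal \<tau>" for \<tau>
  proof (rule ccontr)
    assume "v \<tau> \<noteq> 0"
    moreover have "perturbation_value X F 0 < \<infinity>"
      using primal_finite by (auto simp: p_def)
    ultimately have "ereal \<tau> \<le> \<tau>\<^sub>d"
      using le_biconjugate_0_if_level_value_neq_0[OF X_convex F_convex N_norm]
      by (simp add: dual_def p_def v_def)
    with that show False
      by simp
  qed
  have "\<tau>\<^sub>d = Inf {ereal \<tau> | \<tau>. v \<tau> = 0}"
  proof (rule order_antisym)
    show "\<tau>\<^sub>d \<le> Inf {ereal \<tau> | \<tau>. v \<tau> = 0}"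
      using lower by (auto intro: Inf_greatest)
    show "Inf {ereal \<tau> | \<tau>. v \<tau> = 0} \<le> \<tau>\<^sub>d"
    \<comment> \<open>As \<open>\<tau>\<^sub>d\<close> may be \<open>-\<infinity>\<close>, the
      comparison runs over its real upper bounds \<open>r\<close>. Vanishing of \<open>v\<close> is
      known only strictly above \<open>\<tau>\<^sub>d\<close>, hence the shift to
      \<open>r + e\<close>.\<close>
    proof (rule ereal_le_real)
      fix r assume "\<tau>\<^sub>d \<le> ereal r"
      show "Inf {ereal \<tau> | \<tau>. v \<tau> = 0} \<le> ereal r"
      proof (rule ereal_le_epsilon2)
        fix e :: real assume "e > 0"
        with \<open>\<tau>\<^sub>d \<le> ereal r\<close> have "\<tau>\<^sub>d < ereal (r + e)"
          by (auto elim: le_less_trans)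
        then show "Inf {ereal \<tau> | \<tau>. v \<tau> = 0} \<le> ereal r + ereal e"
          using zero by (auto intro!: Inf_lower)
      qed
    qed
  qed
  with zero show ?thesis
    by blast
qed

end
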